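(* Let $K$ be a field, $S=K[x_1,\dots,x_n]$, and let $Q$ and $Q'$ be two monomial primary ideals of $S$ with $\sqrt{Q}=(x_1,\dots,x_t)$ and $\sqrt{Q'}=(x_{t+1},\dots,x_n)$, where $2\leq t<n$ and $n\geq 4$. Then $$\operatorname{sdepth}(Q\cap Q')\leq \frac{n+2}{2}.$$
   Context: Let $S=K[x_1,\dots,x_n]$ be a polynomial ring over a field $K$ with its standard $\mathbb{Z}^n$-grading, and let $M$ be a nonzero finitely generated $\mathbb{Z}^n$-graded $S$-module. For a homogeneous element $w\in M$ and a subset $Z\subset\{x_1,\dots,x_n\}$, $wK[Z]$ denotes the $K$-subspace of $M$ generated by all elements $wv$ with $v$ a monomial in $K[Z]$. It is called a Stanley space of dimension $|Z|$ if it is a free $K[Z]$-module. A Stanley decomposition of $M$ is a presentation of the $K$-vector space $M$ as a finite direct sum of Stanley spaces $\mathcal{D}: M=\bigoplus_{i=1}^s u_iK[Z_i]$, and $\operatorname{sdepth}\mathcal{D}=\min\{|Z_i| : i=1,\dots,s\}$. The Stanley depth of $M$ is $\operatorname{sdepth}(M)=\max\{\operatorname{sdepth}\mathcal{D} : \mathcal{D}\text{ a Stanley decomposition of } M\}$. *)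

theory Defs
  imports Complex_Main "HOL-Library.Poly_Mapping" "HOL-Algebra.Ideal" "HOL-Algebra.Module"
begin

section \<open>The polynomial ring in n variables\<close>

text \<open>
  A monomial is a finitely supported exponent vector of type \<^typ>\<open>nat \<Rightarrow>\<^sub>0 nat\<close>, and a polynomial
  is a finitely supported family of coefficients indexed by monomials.  The variables of the ring
  in \<open>n\<close> variables are those with index in \<open>{1..n}\<close>, so sets of variables are sets of indices.
\<close>

type_synonym 'k mpoly = "(nat \<Rightarrow>\<^sub>0 nat) \<Rightarrow>\<^sub>0 'k"

definition polys_in :: "nat set \<Rightarrow> 'k::field mpoly set" where
  "polys_in Z = {p. \<forall>m \<in> Poly_Mapping.keys p. Poly_Mapping.keys m \<subseteq> Z}"

definition poly_ring :: "nat \<Rightarrow> 'k::field mpoly ring" where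
  "poly_ring n = \<lparr>carrier = polys_in {1..n}, mult = (*), one = 1, zero = 0, add = (+)\<rparr>"

definition monom :: "(nat \<Rightarrow>\<^sub>0 nat) \<Rightarrow> 'k::field mpoly" where
  "monom m = Poly_Mapping.single m 1"

definition const :: "'k \<Rightarrow> 'k::field mpoly" where
  "const c = Poly_Mapping.single 0 c"

definition var :: "nat \<Rightarrow> 'k::field mpoly" where
  "var i = monom (Poly_Mapping.single i 1)"


section \<open>Ideals\<close>

definition radical :: "('a, 'b) ring_scheme \<Rightarrow> 'a set \<Rightarrow> 'a set" where
  "radical R I = {x \<in> carrier R. \<exists>k::nat. k > 0 \<and> x [^]\<^bsub>R\<^esub> k \<in> I}"

definition primary_ideal :: "'a set \<Rightarrow> ('a, 'b) ring_scheme \<Rightarrow> bool" where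
  "primary_ideal I R \<longleftrightarrow> ideal I R \<and> I \<noteq> carrier R \<and>
     (\<forall>a \<in> carrier R. \<forall>b \<in> carrier R.
        a \<otimes>\<^bsub>R\<^esub> b \<in> I \<longrightarrow> a \<in> I \<or> (\<exists>k::nat. k > 0 \<and> b [^]\<^bsub>R\<^esub> k \<in> I))"

definition monomial_ideal :: "nat \<Rightarrow> 'k::field mpoly set \<Rightarrow> bool" where
  "monomial_ideal n I \<longleftrightarrow>
     (\<exists>A. A \<subseteq> {m. Poly_Mapping.keys m \<subseteq> {1..n}} \<and> I = Idl\<^bsub>poly_ring n\<^esub> (monom ` A))"


section \<open>Multigraded modules and Stanley depth\<close>

text \<open>The group of degrees: integer vectors indexed by \<open>{1..n}\<close>, extended by 0.\<close>

definition Zn :: "nat \<Rightarrow> (nat \<Rightarrow> int) set" where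
  "Zn n = {a. \<forall>i. i \<notin> {1..n} \<longrightarrow> a i = 0}"

definition mdeg :: "(nat \<Rightarrow>\<^sub>0 nat) \<Rightarrow> nat \<Rightarrow> int" where
  "mdeg m = (\<lambda>i. int (Poly_Mapping.lookup m i))"

locale zn_graded_module = module "poly_ring n :: 'k::field mpoly ring" M
  for n :: nat and M :: "('k::field mpoly, 'm, 'c) module_scheme" +
  fixes gr :: "(nat \<Rightarrow> int) \<Rightarrow> 'm set"
  assumes gr_subgroup: "a \<in> Zn n \<Longrightarrow> additive_subgroup (gr a) M"
    and gr_smult: "\<lbrakk>a \<in> Zn n; w \<in> gr a; Poly_Mapping.keys m \<subseteq> {1..n}\<rbrakk> \<Longrightarrow>
      Poly_Mapping.single m c \<odot>\<^bsub>M\<^esub> w \<in> gr (\<lambda>i. a i + mdeg m i)"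
    and gr_direct_sum: "x \<in> carrier M \<Longrightarrow>
      \<exists>!f. f \<in> (\<Pi>\<^sub>E a \<in> Zn n. gr a) \<and> finite {a \<in> Zn n. f a \<noteq> \<zero>\<^bsub>M\<^esub>} \<and>
           x = finsum M f {a \<in> Zn n. f a \<noteq> \<zero>\<^bsub>M\<^esub>}"
begin

definition homogeneous :: "'m \<Rightarrow> bool" where
  "homogeneous w \<longleftrightarrow> (\<exists>a \<in> Zn n. w \<in> gr a)"

definition K_span :: "'m set \<Rightarrow> 'm set" where
  "K_span B = {finsum M (\<lambda>b. const (c b) \<odot>\<^bsub>M\<^esub> b) F | c F. finite F \<and> F \<subseteq> B}"

definition wK :: "'m \<Rightarrow> nat set \<Rightarrow> 'm set" where
  "wK w Z = K_span {monom v \<odot>\<^bsub>M\<^esub> w | v. Poly_Mapping.keys v \<subseteq> Z}"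

text \<open>
  The space \<^term>\<open>wK w Z\<close> is the cyclic module over the polynomials in the variables \<open>Z\<close> that is
  generated by \<open>w\<close>; it is free (of rank one) iff \<open>w\<close> has zero annihilator in that ring.  In
  particular \<open>w\<close> is nonzero.
\<close>

definition stanley_space :: "'m \<Rightarrow> nat set \<Rightarrow> bool" where
  "stanley_space w Z \<longleftrightarrow> w \<in> carrier M \<and> homogeneous w \<and> Z \<subseteq> {1..n} \<and>
     (\<forall>p \<in> polys_in Z. p \<odot>\<^bsub>M\<^esub> w = \<zero>\<^bsub>M\<^esub> \<longrightarrow> p = 0)"

text \<open>A decomposition is given by the list of the pairs consisting of \<open>u\<^sub>i\<close> and \<open>Z\<^sub>i\<close>.\<close>

definition stanley_decomposition :: "('m \<times> nat set) list \<Rightarrow> bool" where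
  "stanley_decomposition D \<longleftrightarrow>
     (\<forall>(u, Z) \<in> set D. stanley_space u Z) \<and>
     (\<forall>x \<in> carrier M. \<exists>!f. f \<in> (\<Pi>\<^sub>E i \<in> {..<length D}. wK (fst (D ! i)) (snd (D ! i))) \<and>
        x = finsum M f {..<length D})"

definition sdepth_decomposition :: "('m \<times> nat set) list \<Rightarrow> nat" where
  "sdepth_decomposition D = Min ((\<lambda>(u, Z). card Z) ` set D)"

definition sdepth :: nat where
  "sdepth = Max {sdepth_decomposition D | D. stanley_decomposition D}"

end


section \<open>Monomial ideals as graded modules\<close>

text \<open>
  A module record contains the fields of a ring record; its fields \<open>mult\<close> and \<open>one\<close> play no role
  in the module structure.
\<close>

definition ideal_module :: "nat \<Rightarrow> 'k::field mpoly set \<Rightarrow> ('k mpoly, 'k mpoly) module" where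
  "ideal_module n I = \<lparr>carrier = I, mult = (*), one = 1, zero = 0, add = (+), smult = (*)\<rparr>"

definition ideal_comp :: "'k::field mpoly set \<Rightarrow> (nat \<Rightarrow> int) \<Rightarrow> 'k mpoly set" where
  "ideal_comp I a = {p \<in> I. \<forall>m \<in> Poly_Mapping.keys p. mdeg m = a}"

definition ideal_sdepth :: "nat \<Rightarrow> 'k::field mpoly set \<Rightarrow> nat" where
  "ideal_sdepth n I = zn_graded_module.sdepth n (ideal_module n I) (ideal_comp I)"

lemma polys_in_add: "p \<in> polys_in Z \<Longrightarrow> q \<in> polys_in Z \<Longrightarrow> p + q \<in> polys_in Z"
  using Poly_Mapping.keys_add[of p q] by (auto simp: polys_in_def)

lemma polys_in_mult:
  assumes "p \<in> polys_in Z" "q \<in> polys_in Z" shows "p * q \<in> polys_in Z"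
  unfolding polys_in_def
proof safe
  fix m i assume "m \<in> Poly_Mapping.keys (p * q)" and i: "i \<in> Poly_Mapping.keys m"
  then obtain a b where "m = a + b" "a \<in> Poly_Mapping.keys p" "b \<in> Poly_Mapping.keys q"
    using keys_mult[of p q] by blast
  with i assms show "i \<in> Z"
    using Poly_Mapping.keys_add[of a b] unfolding polys_in_def by blast
qed

lemma cring_poly_ring: "cring (poly_ring n :: 'k::field mpoly ring)"
proof (rule cringI)
  show "abelian_group (poly_ring n :: 'k mpoly ring)"
  proof (rule abelian_groupI)
    fix x :: "'k mpoly" assume "x \<in> carrier (poly_ring n)"
    then show "\<exists>y\<in>carrier (poly_ring n). y \<oplus>\<^bsub>poly_ring n\<^esub> x = \<zero>\<^bsub>poly_ring n\<^esub>"
      by (intro bexI[of _ "- x"]) (auto simp: poly_ring_def polys_in_def)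
  qed (auto simp: poly_ring_def polys_in_add algebra_simps, auto simp: polys_in_def)
  show "Group.comm_monoid (poly_ring n :: 'k mpoly ring)"
    by unfold_locales
      (auto simp: poly_ring_def polys_in_mult algebra_simps, auto simp: polys_in_def)
qed (auto simp: poly_ring_def algebra_simps)

lemma ideal_monomial_ideal:
  fixes I :: "'k::field mpoly set"
  assumes "monomial_ideal n I" shows "ideal I (poly_ring n)"
proof -
  interpret cring "poly_ring n :: 'k mpoly ring" by (rule cring_poly_ring)
  from assms obtain A where A: "A \<subseteq> {m. Poly_Mapping.keys m \<subseteq> {1..n}}"
    and I: "I = Idl\<^bsub>poly_ring n\<^esub> (monom ` A)" unfolding monomial_ideal_def by blast
  from A have "monom ` A \<subseteq> carrier (poly_ring n :: 'k mpoly ring)"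
    by (fastforce simp: poly_ring_def polys_in_def monom_def)
  then show ?thesis unfolding I by (rule genideal_ideal)
qed

lemma ideal_poly_ringD:
  assumes "ideal I (poly_ring n)"
  shows "0 \<in> I" and "p \<in> I \<Longrightarrow> q \<in> I \<Longrightarrow> p + q \<in> I" and "p \<in> I \<Longrightarrow> - p \<in> I"
    and "p \<in> I \<Longrightarrow> r \<in> polys_in {1..n} \<Longrightarrow> r * p \<in> I" and "I \<subseteq> polys_in {1..n}"
proof -
  have sub: "additive_subgroup I (poly_ring n)" by (rule ideal.axioms(1)[OF assms])
  show "0 \<in> I" using additive_subgroup.zero_closed[OF sub] by (simp add: poly_ring_def)
  show "p \<in> I \<Longrightarrow> q \<in> I \<Longrightarrow> p + q \<in> I"
    using additive_subgroup.a_closed[OF sub, of p q] by (simp add: poly_ring_def)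
  show "I \<subseteq> polys_in {1..n}"
    using additive_subgroup.a_subset[OF sub] by (simp add: poly_ring_def)
  show *: "p \<in> I \<Longrightarrow> r \<in> polys_in {1..n} \<Longrightarrow> r * p \<in> I" for r p
    using ideal.I_l_closed[OF assms, of p r] by (simp add: poly_ring_def)
  have "- 1 \<in> polys_in {1..n}" by (simp add: polys_in_def)
  then show "p \<in> I \<Longrightarrow> - p \<in> I" using *[of p "- 1"] by simp
qed

lemma monomial_ideal_terms:
  fixes I :: "'k::field mpoly set"
  assumes I: "monomial_ideal n I" and p: "p \<in> I" and m: "m \<in> Poly_Mapping.keys p"
  shows "monom m \<in> I"
proof -
  from I obtain A where A: "A \<subseteq> {m. Poly_Mapping.keys m \<subseteq> {1..n}}"
    and IA: "I = Idl\<^bsub>poly_ring n\<^esub> (monom ` A)" by (auto simp: monomial_ideal_def)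
  interpret R: cring "poly_ring n :: 'k mpoly ring" by (rule cring_poly_ring)
  note D = ideal_poly_ringD[OF ideal_monomial_ideal[OF I]]
  define J where "J = {p \<in> I. \<forall>m \<in> Poly_Mapping.keys p. monom m \<in> I}"
  have Jadd: "p + q \<in> J" if "p \<in> J" "q \<in> J" for p q
    using that Poly_Mapping.keys_add[of p q] D(2) by (auto simp: J_def)
  have Jmult: "r * p \<in> J" if p: "p \<in> J" and r: "r \<in> polys_in {1..n}" for p r
  proof -
    have "monom m \<in> I" if "m \<in> Poly_Mapping.keys (r * p)" for m
    proof -
      from that obtain a b where ab: "m = a + b" "a \<in> Poly_Mapping.keys r" "b \<in> Poly_Mapping.keys p"
        using keys_mult[of r p] by blast
      have "monom m = monom a * (monom b :: 'k mpoly)"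
        by (simp add: monom_def ab mult_single)
      moreover have "monom a \<in> polys_in {1..n}"
        using r ab by (auto simp: polys_in_def monom_def)
      ultimately show ?thesis using D(4) p ab(3) by (auto simp: J_def)
    qed
    then show ?thesis using that D(4) by (auto simp: J_def)
  qed
  have "ideal J (poly_ring n)"
  proof (rule idealI[OF R.ring_axioms])
    show "subgroup J (add_monoid (poly_ring n))"
    proof (rule R.add.subgroupI)
      show "J \<subseteq> carrier (poly_ring n)" using D(5) by (auto simp: J_def poly_ring_def)
      show "J \<noteq> {}" using D(1) by (auto simp: J_def)
      show "x \<oplus>\<^bsub>poly_ring n\<^esub> y \<in> J" if "x \<in> J" "y \<in> J" for x y
        using that Jadd by (auto simp: poly_ring_def)
      show "\<ominus>\<^bsub>poly_ring n\<^esub> x \<in> J" if "x \<in> J" for x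
      proof -
        have c: "x \<in> polys_in {1..n}" "- x \<in> polys_in {1..n}"
          using that D(5) by (auto simp: J_def polys_in_def)
        have "\<ominus>\<^bsub>poly_ring n\<^esub> x = - x"
          using c by (intro R.minus_equality) (auto simp: poly_ring_def)
        moreover have "- x \<in> J" using Jmult[OF that, of "- 1"] by (auto simp: polys_in_def)
        ultimately show ?thesis by simp
      qed
    qed
  qed (use Jmult in \<open>auto simp: poly_ring_def mult.commute\<close>)
  moreover have "monom ` A \<subseteq> J"
  proof -
    have "monom ` A \<subseteq> carrier (poly_ring n :: 'k mpoly ring)"
      using A by (fastforce simp: poly_ring_def polys_in_def monom_def)
    then have "monom ` A \<subseteq> I" unfolding IA by (rule R.genideal_self)
    then show ?thesis by (auto simp: J_def monom_def)
  qed
  ultimately have "I \<subseteq> J" unfolding IA by (rule R.genideal_minimal)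
  with p m show ?thesis by (auto simp: J_def)
qed

lemma finsum_ideal_module:
  assumes "ideal I (poly_ring n)" and "\<And>a. a \<in> F \<Longrightarrow> f a \<in> I" and "finite F"
    and "abelian_group (ideal_module n I)"
  shows "finsum (ideal_module n I) f F = (\<Sum>a\<in>F. f a)"
proof -
  interpret abelian_group "ideal_module n I" by fact
  show ?thesis
    using assms(3,2)
  proof (induction F rule: finite_induct)
    case (insert x F)
    then have "finsum (ideal_module n I) f (insert x F) = f x \<oplus>\<^bsub>ideal_module n I\<^esub> finsum (ideal_module n I) f F"
      by (intro finsum_insert) (auto simp: ideal_module_def)
    with insert show ?case by (auto simp: ideal_module_def)
  qed (simp, simp add: ideal_module_def)
qed

text \<open>Every monomial ideal is a multigraded submodule of the polynomial ring.\<close>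

lemma zn_graded_module_ideal:
  fixes I :: "'k::field mpoly set"
  assumes I: "monomial_ideal n I"
  shows "zn_graded_module n (ideal_module n I) (ideal_comp I)"
proof -
  note ideal = ideal_monomial_ideal[OF I]
  note D = ideal_poly_ringD[OF ideal]
  have ag: "abelian_group (ideal_module n I)"
  proof (rule abelian_groupI)
    fix x assume "x \<in> carrier (ideal_module n I)"
    then show "\<exists>y\<in>carrier (ideal_module n I). y \<oplus>\<^bsub>ideal_module n I\<^esub> x = \<zero>\<^bsub>ideal_module n I\<^esub>"
      using D(3) by (intro bexI[of _ "- x"]) (auto simp: ideal_module_def)
  qed (auto simp: ideal_module_def D algebra_simps)
  interpret M: abelian_group "ideal_module n I" by fact
  have uminus: "\<ominus>\<^bsub>ideal_module n I\<^esub> x = - x" if "x \<in> I" for x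
    using that D(3) by (intro M.minus_equality) (auto simp: ideal_module_def)
  have inj: "m = m'" if "mdeg m = mdeg m'" for m m'
    using that by (auto simp: mdeg_def fun_eq_iff intro: poly_mapping_eqI)
  have mod: "module (poly_ring n) (ideal_module n I)"
    by (rule moduleI[OF cring_poly_ring ag])
      (auto simp: ideal_module_def poly_ring_def D algebra_simps)
  show ?thesis
  proof (intro zn_graded_module.intro mod zn_graded_module_axioms.intro)
    fix a show "additive_subgroup (ideal_comp I a) (ideal_module n I)"
    proof (rule additive_subgroup.intro, rule M.add.subgroupI)
      show "x \<oplus>\<^bsub>ideal_module n I\<^esub> y \<in> ideal_comp I a" if "x \<in> ideal_comp I a" "y \<in> ideal_comp I a" for x y
        using that D(2) Poly_Mapping.keys_add[of x y] by (auto simp: ideal_comp_def ideal_module_def)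
      show "\<ominus>\<^bsub>ideal_module n I\<^esub> x \<in> ideal_comp I a" if "x \<in> ideal_comp I a" for x
        using that D(3) uminus by (auto simp: ideal_comp_def)
      show "ideal_comp I a \<noteq> {}" using D(1) by (auto simp: ideal_comp_def)
    qed (auto simp: ideal_comp_def ideal_module_def)
  next
    fix a w and m :: "nat \<Rightarrow>\<^sub>0 nat" and c :: 'k
    assume w: "w \<in> ideal_comp I a" and m: "Poly_Mapping.keys m \<subseteq> {1..n}"
    have "Poly_Mapping.single m c * w \<in> I"
      using w m by (intro D) (auto simp: ideal_comp_def polys_in_def split: if_splits)
    moreover have "mdeg k = (\<lambda>i. a i + mdeg m i)"
      if k: "k \<in> Poly_Mapping.keys (Poly_Mapping.single m c * w)" for k
    proof -
      from k obtain u v where uv: "k = u + v" "u \<in> Poly_Mapping.keys (Poly_Mapping.single m c)"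
        "v \<in> Poly_Mapping.keys w"
        using keys_mult[of "Poly_Mapping.single m c" w] by blast
      then have "u = m" "mdeg v = a" using w by (auto simp: ideal_comp_def split: if_splits)
      with uv show ?thesis by (auto simp: mdeg_def lookup_add)
    qed
    ultimately show "Poly_Mapping.single m c \<odot>\<^bsub>ideal_module n I\<^esub> w \<in> ideal_comp I (\<lambda>i. a i + mdeg m i)"
      by (auto simp: ideal_comp_def ideal_module_def)
  next
    fix x assume "x \<in> carrier (ideal_module n I)"
    then have x: "x \<in> I" by (simp add: ideal_module_def)
    have deg: "mdeg m \<in> Zn n" if "m \<in> Poly_Mapping.keys p" "p \<in> I" for m p
    proof -
      have "Poly_Mapping.keys m \<subseteq> {1..n}" using that D(5) by (auto simp: polys_in_def)
      then show ?thesis by (auto simp: Zn_def mdeg_def in_keys_iff)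
    qed
    let ?S = "\<lambda>f. {a \<in> Zn n. f a \<noteq> (0 :: 'k mpoly)}"
    have lookup_f: "Poly_Mapping.lookup (\<Sum>a\<in>?S f. f a) m = (if mdeg m \<in> Zn n then Poly_Mapping.lookup (f (mdeg m)) m else 0)"
      if f: "f \<in> (\<Pi>\<^sub>E a\<in>Zn n. ideal_comp I a)" and fin: "finite (?S f)" for f m
    proof -
      have z: "Poly_Mapping.lookup (f a) m = 0" if "a \<in> Zn n" "a \<noteq> mdeg m" for a
      proof -
        have "f a \<in> ideal_comp I a" using f that by blast
        then have "m \<notin> Poly_Mapping.keys (f a)" using that by (auto simp: ideal_comp_def)
        then show ?thesis by (simp add: in_keys_iff)
      qed
      have "Poly_Mapping.lookup (\<Sum>a\<in>?S f. f a) m = (\<Sum>a\<in>?S f. Poly_Mapping.lookup (f a) m)"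
        by (simp add: lookup_sum)
      also have "\<dots> = (\<Sum>a\<in>?S f. if a = mdeg m then Poly_Mapping.lookup (f (mdeg m)) m else 0)"
        using z by (intro sum.cong) auto
      also have "\<dots> = (if mdeg m \<in> Zn n then Poly_Mapping.lookup (f (mdeg m)) m else 0)"
        using fin by (auto simp: sum.delta')
      finally show ?thesis .
    qed
    have fs: "finsum (ideal_module n I) f (?S f) = (\<Sum>a\<in>?S f. f a)"
      if "f \<in> (\<Pi>\<^sub>E a\<in>Zn n. ideal_comp I a)" "finite (?S f)" for f
      using that by (intro finsum_ideal_module[OF ideal _ _ ag]) (auto simp: ideal_comp_def PiE_iff)
    define g where "g = (\<lambda>a\<in>Zn n. \<Sum>m | m \<in> Poly_Mapping.keys x \<and> mdeg m = a. Poly_Mapping.single m (Poly_Mapping.lookup x m))"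
    have g_deg: "g (mdeg m) = Poly_Mapping.single m (Poly_Mapping.lookup x m)" if "mdeg m \<in> Zn n" for m
    proof (cases "m \<in> Poly_Mapping.keys x")
      case True
      then have "{m'. m' \<in> Poly_Mapping.keys x \<and> mdeg m' = mdeg m} = {m}" using inj by auto
      then show ?thesis using that by (simp add: g_def)
    next
      case False
      then have *: "{m'. m' \<in> Poly_Mapping.keys x \<and> mdeg m' = mdeg m} = {}" using inj by auto
      have "g (mdeg m) = 0" using that unfolding g_def by (simp add: *)
      then show ?thesis using False by (simp add: in_keys_iff)
    qed
    have g0: "g a = 0" if "a \<in> Zn n" "a \<notin> mdeg ` Poly_Mapping.keys x" for a
    proof -
      have *: "{m. m \<in> Poly_Mapping.keys x \<and> mdeg m = a} = {}" using that by auto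
      show ?thesis using that unfolding g_def by (simp add: *)
    qed
    have gfin: "finite (?S g)"
      by (rule finite_subset[of _ "mdeg ` Poly_Mapping.keys x"]) (use g0 in auto)
    have gI: "g a \<in> ideal_comp I a" if a: "a \<in> Zn n" for a
    proof (cases "a \<in> mdeg ` Poly_Mapping.keys x")
      case True
      then obtain m where m: "m \<in> Poly_Mapping.keys x" "a = mdeg m" by auto
      have "Poly_Mapping.single 0 (Poly_Mapping.lookup x m) * monom m \<in> I"
        by (rule D(4)[OF monomial_ideal_terms[OF I x m(1)]]) (auto simp: polys_in_def)
      then have "Poly_Mapping.single m (Poly_Mapping.lookup x m) \<in> I"
        by (simp add: monom_def mult_single)
      then show ?thesis using g_deg a m by (auto simp: ideal_comp_def split: if_splits)
    qed (use g0 a D(1) in \<open>auto simp: ideal_comp_def\<close>)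
    then have g: "g \<in> (\<Pi>\<^sub>E a\<in>Zn n. ideal_comp I a)"
      by (auto simp: PiE_iff g_def)
    have xg: "x = (\<Sum>a\<in>?S g. g a)"
    proof (rule poly_mapping_eqI)
      fix m show "Poly_Mapping.lookup x m = Poly_Mapping.lookup (\<Sum>a\<in>?S g. g a) m"
        unfolding lookup_f[OF g gfin] using g_deg[of m] deg[OF _ x, of m] by (auto simp: in_keys_iff)
    qed
    have uniq: "f = g" if f: "f \<in> (\<Pi>\<^sub>E a\<in>Zn n. ideal_comp I a)" and fin: "finite (?S f)"
      and xf: "x = (\<Sum>a\<in>?S f. f a)" for f
    proof (rule PiE_ext[OF f g])
      fix a assume a: "a \<in> Zn n"
      show "f a = g a"
      proof (rule poly_mapping_eqI)
        fix m
        show "Poly_Mapping.lookup (f a) m = Poly_Mapping.lookup (g a) m"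
        proof (cases "mdeg m = a")
          case True
          then have "Poly_Mapping.lookup (f a) m = Poly_Mapping.lookup (\<Sum>a\<in>?S f. f a) m"
            using a by (simp only: lookup_f[OF f fin]) simp
          also have "\<dots> = Poly_Mapping.lookup (\<Sum>a\<in>?S g. g a) m"
            by (simp only: xf[symmetric] xg[symmetric])
          also have "\<dots> = Poly_Mapping.lookup (g a) m"
            using a True by (simp only: lookup_f[OF g gfin]) simp
          finally show ?thesis .
        next
          case False
          have "f a \<in> ideal_comp I a" "g a \<in> ideal_comp I a" using f g a by blast+
          then have "m \<notin> Poly_Mapping.keys (f a)" "m \<notin> Poly_Mapping.keys (g a)"
            using False by (auto simp: ideal_comp_def)
          then show ?thesis by (simp add: in_keys_iff)
        qed
      qed
    qed
    have zero: "\<zero>\<^bsub>ideal_module n I\<^esub> = 0" by (simp add: ideal_module_def)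
    show "\<exists>!f. f \<in> (\<Pi>\<^sub>E a\<in>Zn n. ideal_comp I a) \<and> finite {a \<in> Zn n. f a \<noteq> \<zero>\<^bsub>ideal_module n I\<^esub>} \<and>
           x = finsum (ideal_module n I) f {a \<in> Zn n. f a \<noteq> \<zero>\<^bsub>ideal_module n I\<^esub>}"
      unfolding zero
    proof (rule ex1I[of _ g])
      show "g \<in> (\<Pi>\<^sub>E a\<in>Zn n. ideal_comp I a) \<and> finite (?S g) \<and> x = finsum (ideal_module n I) g (?S g)"
        by (intro conjI g gfin) (simp only: fs[OF g gfin] xg[symmetric])
    next
      fix f
      assume *: "f \<in> (\<Pi>\<^sub>E a\<in>Zn n. ideal_comp I a) \<and> finite (?S f) \<and> x = finsum (ideal_module n I) f (?S f)"
      then have f: "f \<in> (\<Pi>\<^sub>E a\<in>Zn n. ideal_comp I a)" "finite (?S f)" by blast+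
      from * have "x = (\<Sum>a\<in>?S f. f a)" by (simp only: fs[OF f])
      with f show "f = g" by (rule uniq)
    qed
  qed
qed

end

theory Submission
  imports Defs
begin

text \<open>
  A Stanley decomposition of a monomial ideal \<open>I\<close> amounts to a partition of the exponent vectors of
  \<open>I\<close> into cones \<open>a\<^sub>i + \<nat>\<^bsup>Z\<^sub>i\<^esup>\<close>.  Let \<open>X = {1..t}\<close>, \<open>Y = {t+1..n}\<close>, and let \<open>N\<close> exceed all exponents
  occurring in the \<open>a\<^sub>i\<close>.  For \<open>S \<subseteq> X \<union> Y\<close> meeting \<open>X\<close> and \<open>Y\<close>, the vector with value \<open>N\<close> on \<open>S\<close> and
  \<open>0\<close> elsewhere lies in the \<open>i\<close>-th cone iff \<open>supp a\<^sub>i \<subseteq> S \<subseteq> Z\<^sub>i\<close>, so these intervals partition the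
  family of all such \<open>S\<close>.  Each of its \<open>|X| |Y|\<close> pairs is the bottom of its own interval, which contains
  at least \<open>d - 2\<close> triples if \<open>d \<le> |Z\<^sub>i|\<close> for all \<open>i\<close>.  As there are \<open>|X| |Y| (n - 2) / 2\<close> triples, this
  gives \<open>d \<le> (n + 2) / 2\<close>.
\<close>

subsection \<open>Interval partitions of the subsets meeting two sides\<close>

lemma ex1_unique: "\<lbrakk>\<exists>!x. P x; P x; P y\<rbrakk> \<Longrightarrow> x = y"
  by blast

text \<open>Double counting of flags \<open>((p, q), z)\<close>: a pair with one element on each
  side and a third element \<open>z\<close>. In \<open>T\<close> all flags occur, in
  \<open>G\<close> those with \<open>z\<close> in the top of the interval that starts at
  \<open>{p, q}\<close>. Two disjoint copies of \<open>G\<close> fit into \<open>T\<close>, and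
  dividing \<open>2 * card G \<le> card T\<close> by the number of pairs gives the bound.\<close>

lemma interval_partition_bound:
  fixes X Y :: "'a set" and A Z :: "nat \<Rightarrow> 'a set" and l d :: nat
  assumes fin: "finite X" "finite Y" and disj: "X \<inter> Y = {}" and ne: "X \<noteq> {}" "Y \<noteq> {}"
    and meet: "\<And>i. i < l \<Longrightarrow> A i \<inter> X \<noteq> {} \<and> A i \<inter> Y \<noteq> {}"
    and Z: "\<And>i. i < l \<Longrightarrow> Z i \<subseteq> X \<union> Y" "\<And>i. i < l \<Longrightarrow> d \<le> card (Z i)"
    and part: "\<And>S. S \<subseteq> X \<union> Y \<Longrightarrow> S \<inter> X \<noteq> {} \<Longrightarrow> S \<inter> Y \<noteq> {} \<Longrightarrow>
      \<exists>!i. i < l \<and> A i \<subseteq> S \<and> S \<subseteq> Z i"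
  shows "2 * d \<le> card (X \<union> Y) + 2"
\<comment> \<open>The count uses the truncated difference \<open>d - 2\<close>. For
  \<open>d \<le> 2\<close> it is enough that both sides are nonempty, so that
  \<open>X \<union> Y\<close> has at least two elements.\<close>
proof (cases "d \<le> 2")
  case True
  have "card X \<noteq> 0" "card Y \<noteq> 0" using fin ne by auto
  then show ?thesis using True card_Un_disjoint[OF fin disj] by simp
next
  case False
  define \<iota> where "\<iota> = (\<lambda>p q. THE i. i < l \<and> A i \<subseteq> {p, q} \<and> {p, q} \<subseteq> Z i)"
  have \<iota>: "\<iota> p q < l" "A (\<iota> p q) = {p, q}" "{p, q} \<subseteq> Z (\<iota> p q)" if "p \<in> X" "q \<in> Y" for p q
  proof -
    have "\<exists>!i. i < l \<and> A i \<subseteq> {p, q} \<and> {p, q} \<subseteq> Z i"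
      using that by (intro part) auto
    from theI'[OF this] have *: "\<iota> p q < l" "A (\<iota> p q) \<subseteq> {p, q}" "{p, q} \<subseteq> Z (\<iota> p q)"
      unfolding \<iota>_def by auto
    \<comment> \<open>A subset of \<open>{p, q}\<close> that meets both \<open>X\<close> and
      \<open>Y\<close> is the whole pair.\<close>
    from * meet[OF *(1)] that disj show "\<iota> p q < l" "A (\<iota> p q) = {p, q}" "{p, q} \<subseteq> Z (\<iota> p q)"
      by auto
  qed
  define T where "T = (SIGMA w : X \<times> Y. X \<union> Y - {fst w, snd w})"
  define G where "G = (SIGMA w : X \<times> Y. Z (\<iota> (fst w) (snd w)) - {fst w, snd w})"
  define \<sigma> where "\<sigma> = (\<lambda>((p, q), z). if z \<in> X then ((z, q), p) else ((p, z), q))"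
  text \<open>
    Both \<open>((p, q), z)\<close> and its image under \<open>\<sigma>\<close> represent the triple \<open>{p, q, z}\<close>, which lies in only one
    interval and hence above only one pair; so \<open>\<sigma>\<close> moves \<open>G\<close> off itself.
  \<close>
  have finT: "finite T" unfolding T_def using fin by auto
  have GT: "G \<subseteq> T" unfolding G_def T_def using Z(1) \<iota>(1) by fastforce
  have \<sigma>T: "\<sigma> ` T \<subseteq> T" unfolding T_def \<sigma>_def using disj by (auto split: if_splits)
  \<comment> \<open>Exchanging \<open>z\<close> with the element of the pair on its own side is an
    involution of \<open>T\<close>.\<close>
  have inj: "inj_on \<sigma> T"
    by (rule inj_on_inverseI[of _ \<sigma>]) (use disj in \<open>auto simp: T_def \<sigma>_def split: if_splits\<close>)
  \<comment> \<open>The union of the two pairs lies in both intervals, so these coincide and have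
    the same bottom.\<close>
  have eq: "{p, q} = {p', q'}"
    if "p \<in> X" "q \<in> Y" "p' \<in> X" "q' \<in> Y"
      and "{p', q'} \<subseteq> Z (\<iota> p q)" "{p, q} \<subseteq> Z (\<iota> p' q')" for p q p' q'
  proof -
    let ?S = "{p, q} \<union> {p', q'}"
    have ex: "\<exists>!i. i < l \<and> A i \<subseteq> ?S \<and> ?S \<subseteq> Z i" using that by (intro part) auto
    have *: "\<iota> p q < l \<and> A (\<iota> p q) \<subseteq> ?S \<and> ?S \<subseteq> Z (\<iota> p q)"
      "\<iota> p' q' < l \<and> A (\<iota> p' q') \<subseteq> ?S \<and> ?S \<subseteq> Z (\<iota> p' q')"
      using that \<iota>[of p q] \<iota>[of p' q'] by auto
    have "\<iota> p q = \<iota> p' q'" by (rule ex1_unique[OF ex *])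
    then show ?thesis using \<iota>(2)[of p q] \<iota>(2)[of p' q'] that by simp
  qed
  have dis: "G \<inter> \<sigma> ` G = {}"
  proof (rule ccontr)
    assume "G \<inter> \<sigma> ` G \<noteq> {}"
    then obtain p q z where g: "((p, q), z) \<in> G" "\<sigma> ((p, q), z) \<in> G" by auto
    then have pq: "p \<in> X" "q \<in> Y" "z \<in> Z (\<iota> p q)" "z \<noteq> p" "z \<noteq> q" by (auto simp: G_def)
    show False
    proof (cases "z \<in> X")
      case True
      with g(2) have "p \<in> Z (\<iota> z q)" by (auto simp: G_def \<sigma>_def)
      then have "{p, q} = {z, q}"
        using True pq \<iota>(3)[of p q] \<iota>(3)[of z q] by (intro eq) auto
      then show False using pq True disj by (auto simp: doubleton_eq_iff)
    next
      case False
      moreover from g(2) GT have "z \<in> X \<union> Y" using False by (auto simp: G_def \<sigma>_def)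
      ultimately have "z \<in> Y" by simp
      from False g(2) have "q \<in> Z (\<iota> p z)" by (auto simp: G_def \<sigma>_def)
      then have "{p, q} = {p, z}"
        using \<open>z \<in> Y\<close> pq \<iota>(3)[of p q] \<iota>(3)[of p z] by (intro eq) auto
      then show False using pq \<open>z \<in> Y\<close> disj by (auto simp: doubleton_eq_iff)
    qed
  qed
  have finZ: "finite (Z i)" if "i < l" for i
    using Z(1)[OF that] fin by (meson finite_UnI finite_subset)
  have G: "card (X \<times> Y) * (d - 2) \<le> card G"
  proof -
    have "card G = (\<Sum>w\<in>X \<times> Y. card (Z (\<iota> (fst w) (snd w)) - {fst w, snd w}))"
      unfolding G_def using fin finZ \<iota>(1) by (intro card_SigmaI) auto
    also have "\<dots> \<ge> (\<Sum>w\<in>X \<times> Y. d - 2)"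
    proof (rule sum_mono)
      fix w assume "w \<in> X \<times> Y"
      then have w: "fst w \<in> X" "snd w \<in> Y" by auto
      have "card {fst w, snd w} \<le> 2" by (simp add: card_insert_if)
      then show "d - 2 \<le> card (Z (\<iota> (fst w) (snd w)) - {fst w, snd w})"
        using diff_card_le_card_Diff[of "{fst w, snd w}" "Z (\<iota> (fst w) (snd w))"]
          Z(2)[OF \<iota>(1)[OF w]] by simp
    qed
    finally show ?thesis by simp
  qed
  have T: "card T = card (X \<times> Y) * (card (X \<union> Y) - 2)"
  proof -
    have "card T = (\<Sum>w\<in>X \<times> Y. card (X \<union> Y - {fst w, snd w}))"
      unfolding T_def using fin by (intro card_SigmaI) auto
    also have "\<dots> = (\<Sum>w\<in>X \<times> Y. card (X \<union> Y) - 2)"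
    proof (rule sum.cong[OF refl])
      fix w assume "w \<in> X \<times> Y"
      then have "fst w \<in> X" "snd w \<in> Y" by auto
      moreover from this disj have "card {fst w, snd w} = 2" by (auto simp: card_insert_if)
      ultimately show "card (X \<union> Y - {fst w, snd w}) = card (X \<union> Y) - 2"
        by (subst card_Diff_subset) auto
    qed
    finally show ?thesis by simp
  qed
  have "2 * card G = card (G \<union> \<sigma> ` G)"
    using card_Un_disjoint[OF _ _ dis] card_image[OF inj_on_subset[OF inj GT]]
      finite_subset[OF GT finT] by simp
  also have "\<dots> \<le> card T" using GT \<sigma>T finT by (intro card_mono) auto
  finally have "card (X \<times> Y) * (2 * (d - 2)) \<le> card (X \<times> Y) * (card (X \<union> Y) - 2)"
    using G T by linarith
  moreover have "card (X \<times> Y) > 0" using fin ne by (simp add: card_gt_0_iff)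
  ultimately have "2 * (d - 2) \<le> card (X \<union> Y) - 2" by simp
  then show ?thesis using False by linarith
qed

subsection \<open>Monomial ideals and their exponent vectors\<close>

definition expos :: "'k::field mpoly set \<Rightarrow> (nat \<Rightarrow>\<^sub>0 nat) set" where
  "expos I = {m. monom m \<in> I}"

text \<open>These are the exponents of the monomials in the Stanley space
  \<open>x^a K[Z]\<close>.\<close>

definition cone :: "(nat \<Rightarrow>\<^sub>0 nat) \<Rightarrow> nat set \<Rightarrow> (nat \<Rightarrow>\<^sub>0 nat) set" where
  "cone a Z = {a + v | v. Poly_Mapping.keys v \<subseteq> Z}"

lemma cone_iff:
  "m \<in> cone a Z \<longleftrightarrow> (\<forall>i. Poly_Mapping.lookup a i \<le> Poly_Mapping.lookup m i) \<and>
     (\<forall>i. i \<notin> Z \<longrightarrow> Poly_Mapping.lookup m i = Poly_Mapping.lookup a i)" (is "_ \<longleftrightarrow> ?R")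
proof
  assume "m \<in> cone a Z"
  then show ?R by (force simp: cone_def lookup_add in_keys_iff)
next
  assume R: ?R
  \<comment> \<open>Subtraction of exponents is truncated; the pointwise inequality makes it
    exact.\<close>
  have "m = a + (m - a)" using R by (intro poly_mapping_eqI) (simp add: lookup_add lookup_minus)
  moreover have "Poly_Mapping.keys (m - a) \<subseteq> Z"
    using R by (fastforce simp: in_keys_iff lookup_minus)
  ultimately show "m \<in> cone a Z" unfolding cone_def by blast
qed

lemma mpoly_sum_monoms:
  "(\<Sum>m\<in>Poly_Mapping.keys p. const (Poly_Mapping.lookup p m) * monom m) = (p :: 'k::field mpoly)"
proof (rule poly_mapping_eqI)
  fix m
  show "Poly_Mapping.lookup (\<Sum>m\<in>Poly_Mapping.keys p. const (Poly_Mapping.lookup p m) * monom m) m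
    = Poly_Mapping.lookup p m"
    by (auto simp: lookup_sum const_def monom_def mult_single lookup_single when_def in_keys_iff)
qed

lemma ideal_mem_of_monoms:
  fixes J :: "'k::field mpoly set"
  assumes J: "ideal J (poly_ring n)" and monoms: "\<And>m. m \<in> Poly_Mapping.keys p \<Longrightarrow> monom m \<in> J"
  shows "p \<in> J"
proof -
  note D = ideal_poly_ringD[OF J]
  have "(\<Sum>m\<in>F. const (Poly_Mapping.lookup p m) * monom m) \<in> J"
    if "finite F" "F \<subseteq> Poly_Mapping.keys p" for F
    using that
  proof induction
    case (insert m F)
    then have "const (Poly_Mapping.lookup p m) * monom m \<in> J"
      using monoms by (intro D(4)) (auto simp: const_def polys_in_def)
    with insert show ?case by (simp add: D(2))
  qed (simp add: D(1))
  from this[OF finite_keys order.refl] show ?thesis by (simp only: mpoly_sum_monoms)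
qed

text \<open>Converse of \<open>monomial_ideal_terms\<close>: an ideal closed under taking terms is
  generated by the monomials in it. This criterion refers to no particular generators, so it passes
  to intersections.\<close>

lemma monomial_idealI:
  fixes I :: "'k::field mpoly set"
  assumes I: "ideal I (poly_ring n)"
    and terms: "\<And>p m. p \<in> I \<Longrightarrow> m \<in> Poly_Mapping.keys p \<Longrightarrow> monom m \<in> I"
  shows "monomial_ideal n I"
proof -
  interpret R: cring "poly_ring n :: 'k mpoly ring" by (rule cring_poly_ring)
  have sub: "monom ` expos I \<subseteq> I" by (auto simp: expos_def)
  have A: "expos I \<subseteq> {m. Poly_Mapping.keys m \<subseteq> {1..n}}"
    using ideal_poly_ringD(5)[OF I] by (force simp: expos_def polys_in_def monom_def)
  have car: "monom ` expos I \<subseteq> carrier (poly_ring n :: 'k mpoly ring)"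
    using A by (auto simp: poly_ring_def polys_in_def monom_def)
  define J :: "'k mpoly set" where "J = Idl\<^bsub>poly_ring n\<^esub> (monom ` expos I)"
  have J: "ideal J (poly_ring n)" unfolding J_def by (rule R.genideal_ideal[OF car])
  have "monom m \<in> J" if "p \<in> I" "m \<in> Poly_Mapping.keys p" for p m
    unfolding J_def using terms[OF that] R.genideal_self[OF car] by (auto simp: expos_def)
  then have "p \<in> J" if "p \<in> I" for p
    by (rule ideal_mem_of_monoms[OF J]) (use that in blast)
  moreover have "J \<subseteq> I" unfolding J_def by (rule R.genideal_minimal[OF I sub])
  ultimately have "I = J" by blast
  with A show ?thesis unfolding monomial_ideal_def J_def by blast
qed

lemma monomial_ideal_Int:
  assumes "monomial_ideal n I" "monomial_ideal n (J :: 'k::field mpoly set)"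
  shows "monomial_ideal n (I \<inter> J)"
proof (rule monomial_idealI)
  interpret R: cring "poly_ring n :: 'k mpoly ring" by (rule cring_poly_ring)
  show "ideal (I \<inter> J) (poly_ring n)"
    using assms by (intro R.i_intersect ideal_monomial_ideal)
qed (use assms monomial_ideal_terms in blast)

definition trunc :: "nat \<Rightarrow> (nat \<Rightarrow>\<^sub>0 nat) \<Rightarrow> (nat \<Rightarrow>\<^sub>0 nat)" where
  "trunc k m = Poly_Mapping.map (min k) m"

text \<open>\<open>Poly_Mapping.map\<close> acts on the support only, which agrees with capping
  everywhere because \<open>min k 0 = 0\<close>.\<close>

lemma lookup_trunc [simp]: "Poly_Mapping.lookup (trunc k m) i = min k (Poly_Mapping.lookup m i)"
  by (simp add: trunc_def Poly_Mapping.map.rep_eq when_def)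

text \<open>Makes the notions of \<open>zn_graded_module\<close> available for an ideal; it is
  interpreted for \<open>Q\<close>, \<open>Q'\<close> and their intersection.\<close>

locale monomial_ideal_module =
  fixes n :: nat and I :: "'k::field mpoly set"
  assumes monomial: "monomial_ideal n I"
begin

sublocale zn_graded_module n "ideal_module n I" "ideal_comp I"
  by (rule zn_graded_module_ideal[OF monomial])

lemmas ideal_I = ideal_monomial_ideal[OF monomial]
lemmas ideal_I_D = ideal_poly_ringD[OF ideal_I]

lemma abelian_group_ideal_module: "abelian_group (ideal_module n I)" ..

lemmas finsum_eq = finsum_ideal_module[OF ideal_I _ _ abelian_group_ideal_module]

lemma smult_eq [simp]: "p \<odot>\<^bsub>ideal_module n I\<^esub> q = p * q"
  and zero_eq [simp]: "\<zero>\<^bsub>ideal_module n I\<^esub> = 0"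
  and carrier_eq [simp]: "carrier (ideal_module n I) = I"
  by (simp_all add: ideal_module_def)

lemma expos_add:
  assumes "a \<in> expos I" "Poly_Mapping.keys v \<subseteq> {1..n}"
  shows "a + v \<in> expos I"
proof -
  have "monom v * monom a \<in> I"
    using assms by (intro ideal_I_D(4)) (auto simp: expos_def polys_in_def monom_def)
  then show ?thesis by (simp add: expos_def monom_def mult_single add.commute)
qed

lemma cone_subset_expos: "a \<in> expos I \<Longrightarrow> Z \<subseteq> {1..n} \<Longrightarrow> cone a Z \<subseteq> expos I"
  using expos_add by (auto simp: cone_def)

lemma keys_subset_expos: "p \<in> I \<Longrightarrow> Poly_Mapping.keys p \<subseteq> expos I"
  using monomial_ideal_terms[OF monomial] by (auto simp: expos_def)

lemma mem_of_keys_subset: "Poly_Mapping.keys p \<subseteq> expos I \<Longrightarrow> p \<in> I"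
  by (rule ideal_mem_of_monoms[OF ideal_I]) (auto simp: expos_def)

subsection \<open>Stanley decompositions and cones\<close>

text \<open>Distinct monomials have distinct multidegrees, so a homogeneous element has at most one
  term; freeness, tested on the polynomial 1, rules out zero.\<close>

lemma stanley_space_single:
  assumes "stanley_space u Z"
  obtains a c where "u = Poly_Mapping.single a c" "c \<noteq> 0" "a \<in> expos I" "Z \<subseteq> {1..n}"
proof -
  from assms have u: "u \<in> I" "Z \<subseteq> {1..n}" and hom: "homogeneous u"
    and free: "\<And>p. p \<in> polys_in Z \<Longrightarrow> p * u = 0 \<Longrightarrow> p = 0"
    by (auto simp: stanley_space_def)
  have "u \<noteq> 0" using free[of 1] by (auto simp: polys_in_def)
  then obtain a where a: "a \<in> Poly_Mapping.keys u" by (metis ex_in_conv keys_eq_empty)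
  have "m = a" if "m \<in> Poly_Mapping.keys u" for m
  proof -
    have "mdeg m = mdeg a" using hom that a by (auto simp: homogeneous_def ideal_comp_def)
    then show ?thesis by (auto simp: mdeg_def fun_eq_iff intro: poly_mapping_eqI)
  qed
  then have "u = Poly_Mapping.single a (Poly_Mapping.lookup u a)"
    by (intro poly_mapping_eqI) (auto simp: lookup_single when_def in_keys_iff)
  with a u keys_subset_expos[OF u(1)] that show thesis by (auto simp: in_keys_iff)
qed

lemma wK_single:
  assumes a: "a \<in> expos I" and c: "c \<noteq> 0" and Z: "Z \<subseteq> {1..n}"
  shows "wK (Poly_Mapping.single a c) Z = {p. Poly_Mapping.keys p \<subseteq> cone a Z}" (is "wK ?u Z = _")
proof -
  let ?B = "{monom v * ?u | v. Poly_Mapping.keys v \<subseteq> Z}"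
  have B: "\<exists>m\<in>cone a Z. b = Poly_Mapping.single m c" if "b \<in> ?B" for b
    using that by (auto simp: cone_def monom_def mult_single add.commute)
  have BI: "const k * b \<in> I" if "b \<in> ?B" for b k
    using B[OF that] cone_subset_expos[OF a Z]
    by (intro mem_of_keys_subset) (auto simp: const_def mult_single split: if_splits)
  have sum: "finsum (ideal_module n I) (\<lambda>b. const (k b) * b) F = (\<Sum>b\<in>F. const (k b) * b)"
    if "finite F" "F \<subseteq> ?B" for F k
    using that BI by (intro finsum_eq) blast+
  have wK: "wK ?u Z = {(\<Sum>b\<in>F. const (k b) * b) | k F. finite F \<and> F \<subseteq> ?B}"
    unfolding wK_def K_span_def smult_eq by (metis (mono_tags, lifting) sum)
  show ?thesis
  proof (intro equalityI subsetI)
    fix p assume "p \<in> wK ?u Z"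
    then obtain k F where p: "p = (\<Sum>b\<in>F. const (k b) * b)" "F \<subseteq> ?B" unfolding wK by blast
    have "m \<in> cone a Z" if m: "m \<in> Poly_Mapping.keys p" for m
    proof -
      from m obtain b where b: "b \<in> F" "Poly_Mapping.lookup (const (k b) * b) m \<noteq> 0"
        unfolding p(1) in_keys_iff lookup_sum by (meson sum.neutral)
      from B[OF subsetD[OF p(2) b(1)]]
      obtain m' where "m' \<in> cone a Z" "b = Poly_Mapping.single m' c" by blast
      with b(2) show ?thesis by (auto simp: const_def mult_single lookup_single when_def split: if_splits)
    qed
    then show "p \<in> {p. Poly_Mapping.keys p \<subseteq> cone a Z}" by blast
  next
    fix p :: "'k mpoly" assume p: "p \<in> {p. Poly_Mapping.keys p \<subseteq> cone a Z}"
    let ?b = "\<lambda>m. Poly_Mapping.single m c"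
    let ?F = "?b ` Poly_Mapping.keys p"
    \<comment> \<open>\<open>K_span\<close> takes coefficients indexed by generators, not by
      exponents. The exponent of a generator is read off from its one-element support, and its
      scalar \<open>c\<close> is divided out.\<close>
    let ?k = "\<lambda>b. Poly_Mapping.lookup p (the_elem (Poly_Mapping.keys b)) / c"
    have "?F \<subseteq> ?B"
    proof safe
      fix m assume "m \<in> Poly_Mapping.keys p"
      with p obtain v where "m = a + v" "Poly_Mapping.keys v \<subseteq> Z" by (auto simp: cone_def)
      then show "\<exists>v. Poly_Mapping.single m c = monom v * ?u \<and> Poly_Mapping.keys v \<subseteq> Z"
        by (intro exI[of _ v]) (simp add: monom_def mult_single add.commute)
    qed
    moreover have "inj_on ?b (Poly_Mapping.keys p)"
    proof (rule inj_onI)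
      fix x y assume "Poly_Mapping.single x c = Poly_Mapping.single y c"
      then have "Poly_Mapping.keys (Poly_Mapping.single x c) = Poly_Mapping.keys (Poly_Mapping.single y c)"
        by simp
      then show "x = y" using c by simp
    qed
    then have "(\<Sum>b\<in>?F. const (?k b) * b) = (\<Sum>m\<in>Poly_Mapping.keys p. const (Poly_Mapping.lookup p m) * monom m)"
      using c by (simp add: sum.reindex const_def monom_def mult_single)
    then have "(\<Sum>b\<in>?F. const (?k b) * b) = p" by (simp only: mpoly_sum_monoms)
    ultimately show "p \<in> wK ?u Z" unfolding wK by (force intro!: exI[of _ ?k] exI[of _ ?F])
  qed
qed

lemma keys_expos_subset: "m \<in> expos I \<Longrightarrow> Poly_Mapping.keys m \<subseteq> {1..n}"
  using ideal_I_D(5) by (force simp: expos_def polys_in_def monom_def)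

text \<open>Expand the single monomial with exponent \<open>m\<close>. Its coefficient 1 must come
  from some summand, whose cone then contains \<open>m\<close>; two cones containing
  \<open>m\<close> would give two different expansions.\<close>

lemma stanley_decomposition_cones:
  assumes D: "stanley_decomposition D"
  obtains a where "\<And>i. i < length D \<Longrightarrow> a i \<in> expos I"
    and "\<And>i. i < length D \<Longrightarrow> snd (D ! i) \<subseteq> {1..n}"
    and "\<And>m. m \<in> expos I \<Longrightarrow> \<exists>!i. i < length D \<and> m \<in> cone (a i) (snd (D ! i))"
proof -
  let ?Z = "\<lambda>i. snd (D ! i)"
  have space: "stanley_space (fst (D ! i)) (?Z i)" if "i < length D" for i
  proof -
    have "D ! i \<in> set D" using that by simp
    then show ?thesis using D by (auto simp: stanley_decomposition_def split: prod.splits)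
  qed
  have "\<exists>a c. fst (D ! i) = Poly_Mapping.single a c \<and> c \<noteq> 0 \<and> a \<in> expos I \<and> ?Z i \<subseteq> {1..n}"
    if "i < length D" for i
    using stanley_space_single[OF space[OF that]] by metis
  then obtain a c where ac: "fst (D ! i) = Poly_Mapping.single (a i) (c i)" "c i \<noteq> 0"
    "a i \<in> expos I" "?Z i \<subseteq> {1..n}" if "i < length D" for i
    by metis
  have wK: "wK (fst (D ! i)) (?Z i) = {p. Poly_Mapping.keys p \<subseteq> cone (a i) (?Z i)}"
    if "i < length D" for i
    using wK_single[of "a i" "c i" "?Z i"] ac[OF that] by simp
  have wKI: "p \<in> I" if "i < length D" "p \<in> wK (fst (D ! i)) (?Z i)" for i p
    using that wK cone_subset_expos[OF ac(3,4)] by (intro mem_of_keys_subset) blast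
  let ?P = "\<Pi>\<^sub>E i\<in>{..<length D}. wK (fst (D ! i)) (?Z i)"
  have fs: "finsum (ideal_module n I) f {..<length D} = (\<Sum>i<length D. f i)" if "f \<in> ?P" for f
    using that wKI by (intro finsum_eq) (auto simp: PiE_iff)
  have dec: "\<exists>!f. f \<in> ?P \<and> x = finsum (ideal_module n I) f {..<length D}" if "x \<in> I" for x
    using D that by (simp add: stanley_decomposition_def)
  have "\<exists>!i. i < length D \<and> m \<in> cone (a i) (?Z i)" if m: "m \<in> expos I" for m
  proof -
    have mI: "monom m \<in> I" using m by (simp add: expos_def)
    obtain f where f: "f \<in> ?P" "monom m = finsum (ideal_module n I) f {..<length D}"
      using ex1_implies_ex[OF dec[OF mI]] by (elim exE conjE)
    then have "monom m = (\<Sum>i<length D. f i)" by (simp only: fs)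
    from arg_cong[OF this, of "\<lambda>p. Poly_Mapping.lookup p m"]
    have "(\<Sum>i<length D. Poly_Mapping.lookup (f i) m) = 1"
      by (simp add: lookup_sum monom_def)
    then obtain i where i: "i < length D" "Poly_Mapping.lookup (f i) m \<noteq> 0"
      by (metis (no_types, lifting) lessThan_iff sum.neutral zero_neq_one)
    then have "m \<in> cone (a i) (?Z i)"
      using PiE_mem[OF f(1), of i] i wK[OF i(1)] by (auto simp: in_keys_iff)
    moreover have "i = j" if ij: "i < length D" "m \<in> cone (a i) (?Z i)" "j < length D"
      "m \<in> cone (a j) (?Z j)" for i j
    proof (rule ccontr)
      assume "i \<noteq> j"
      let ?f = "\<lambda>i. \<lambda>l\<in>{..<length D}. if l = i then monom m else (0 :: 'k mpoly)"
      have *: "?f l \<in> ?P \<and> monom m = finsum (ideal_module n I) (?f l) {..<length D}"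
        if l: "l < length D" "m \<in> cone (a l) (?Z l)" for l
      proof -
        have "?f l \<in> ?P" using l wK by (auto simp: PiE_iff monom_def)
        then show ?thesis using l(1) by (simp add: fs)
      qed
      have "?f i = ?f j" 
        using *[OF ij(1,2)] *[OF ij(3,4)] by (rule ex1_unique[OF dec[OF mI]])
      then have "?f i i = ?f j i" by (rule fun_cong)
      then have "monom m = (0 :: 'k mpoly)" using \<open>i \<noteq> j\<close> ij(1) by simp
      then show False by (metis lookup_single_eq lookup_zero monom_def zero_neq_one)
    qed
    ultimately show ?thesis using i(1) by blast
  qed
  with ac(3,4) that show thesis by blast
qed

text \<open>Converse of \<open>stanley_decomposition_cones\<close>: a polynomial splits uniquely by
  sorting its terms according to the cone that contains their exponents.\<close>

lemma stanley_decomposition_of_cones: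
  assumes L: "\<And>a Z. (a, Z) \<in> set L \<Longrightarrow> a \<in> expos I \<and> Z \<subseteq> {1..n}"
    and part: "\<And>m. m \<in> expos I \<Longrightarrow> \<exists>!i. i < length L \<and> m \<in> cone (fst (L ! i)) (snd (L ! i))"
  shows "stanley_decomposition (map (\<lambda>(a, Z). (monom a, Z)) L)" (is "stanley_decomposition ?D")
  unfolding stanley_decomposition_def
proof (intro conjI ballI)
  fix uZ assume "uZ \<in> set ?D"
  then obtain a Z where uZ: "uZ = (monom a, Z)" and "(a, Z) \<in> set L" by auto
  then have aZ: "a \<in> expos I" "Z \<subseteq> {1..n}" using L by auto
  have "homogeneous (monom a)" unfolding homogeneous_def
  proof (rule bexI)
    show "monom a \<in> ideal_comp I (mdeg a)"
      using aZ by (auto simp: ideal_comp_def monom_def expos_def)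
    show "mdeg a \<in> Zn n"
      using keys_expos_subset[OF aZ(1)] by (auto simp: Zn_def mdeg_def in_keys_iff)
  qed
  \<comment> \<open>The polynomials have no zero divisors, so a nonzero generator has zero
    annihilator.\<close>
  moreover have "monom a \<noteq> (0 :: 'k mpoly)"
    by (metis lookup_single_eq lookup_zero monom_def zero_neq_one)
  ultimately show "case uZ of (u, Z) \<Rightarrow> stanley_space u Z"
    using aZ by (simp add: uZ stanley_space_def expos_def)
next
  fix x assume "x \<in> carrier (ideal_module n I)"
  then have x: "Poly_Mapping.keys x \<subseteq> expos I" by (simp add: keys_subset_expos)
  let ?C = "\<lambda>i. cone (fst (L ! i)) (snd (L ! i))"
  have Li: "fst (L ! i) \<in> expos I" "snd (L ! i) \<subseteq> {1..n}" if "i < length L" for i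
    using L[of "fst (L ! i)" "snd (L ! i)"] that by auto
  have wK: "wK (fst (?D ! i)) (snd (?D ! i)) = {p. Poly_Mapping.keys p \<subseteq> ?C i}"
    if "i < length L" for i
    using that wK_single[OF Li(1) _ Li(2), OF that _ that, of 1]
    by (simp add: monom_def case_prod_unfold)
  let ?P = "\<Pi>\<^sub>E i\<in>{..<length L}. {p :: 'k mpoly. Poly_Mapping.keys p \<subseteq> ?C i}"
  have P: "(\<Pi>\<^sub>E i\<in>{..<length ?D}. wK (fst (?D ! i)) (snd (?D ! i))) = ?P"
    unfolding length_map by (rule PiE_cong) (simp only: lessThan_iff wK)
  have fs: "finsum (ideal_module n I) f {..<length L} = (\<Sum>i<length L. f i)" if f: "f \<in> ?P" for f
  proof (rule finsum_eq)
    fix i assume "i \<in> {..<length L}"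
    then show "f i \<in> I"
      using f cone_subset_expos[OF Li(1) Li(2), of i i] by (intro mem_of_keys_subset) (auto simp: PiE_iff)
  qed simp
  \<comment> \<open>Only the summand whose cone contains \<open>m\<close> can contribute to the
    coefficient at \<open>m\<close>.\<close>
  have lookup_f: "Poly_Mapping.lookup (\<Sum>i<length L. f i) m = Poly_Mapping.lookup (f j) m"
    if f: "f \<in> ?P" and j: "j < length L" "m \<in> ?C j" for f m j
  proof -
    have m: "m \<in> expos I" using j cone_subset_expos[OF Li(1) Li(2), of j j] by auto
    have "Poly_Mapping.lookup (f i) m = 0" if "i < length L" "i \<noteq> j" for i
    proof -
      have "m \<notin> ?C i" using part[OF m] that j by blast
      then have "m \<notin> Poly_Mapping.keys (f i)" using f that(1) by (auto simp: PiE_iff)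
      then show ?thesis by (simp add: in_keys_iff)
    qed
    then have "(\<Sum>i<length L. Poly_Mapping.lookup (f i) m)
      = (\<Sum>i<length L. if i = j then Poly_Mapping.lookup (f j) m else 0)"
      by (intro sum.cong) auto
    then show ?thesis using j(1) by (simp add: lookup_sum)
  qed
  \<comment> \<open>The component \<open>g i\<close> collects the terms of \<open>x\<close> with
    exponent in the \<open>i\<close>-th cone.\<close>
  define g where "g = (\<lambda>i\<in>{..<length L}. \<Sum>m\<in>Poly_Mapping.keys x \<inter> ?C i.
    const (Poly_Mapping.lookup x m) * monom m)"
  have lookup_g: "Poly_Mapping.lookup (g i) m = (if m \<in> ?C i then Poly_Mapping.lookup x m else 0)"
    if "i < length L" for i m
    using that
    by (auto simp: g_def lookup_sum const_def monom_def mult_single lookup_single when_def in_keys_iff)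
  have gP: "g \<in> ?P"
  proof (rule PiE_I)
    show "g i \<in> {p. Poly_Mapping.keys p \<subseteq> ?C i}" if "i \<in> {..<length L}" for i
      using that lookup_g[of i] by (auto simp: in_keys_iff split: if_splits)
  qed (simp add: g_def)
  show "\<exists>!f. f \<in> (\<Pi>\<^sub>E i\<in>{..<length ?D}. wK (fst (?D ! i)) (snd (?D ! i))) \<and>
    x = finsum (ideal_module n I) f {..<length ?D}"
    unfolding P unfolding length_map
  proof (rule ex1I[of _ g])
    have "x = (\<Sum>i<length L. g i)"
    proof (rule poly_mapping_eqI)
      fix m
      show "Poly_Mapping.lookup x m = Poly_Mapping.lookup (\<Sum>i<length L. g i) m"
      proof (cases "m \<in> expos I")
        case True
        then obtain j where j: "j < length L" "m \<in> ?C j" using part by blast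
        show ?thesis using lookup_f[OF gP j] lookup_g[OF j(1), of m] j(2) by simp
      next
        case False
        then have "Poly_Mapping.lookup x m = 0" using x by (auto simp: in_keys_iff)
        then show ?thesis using lookup_g by (auto simp: lookup_sum intro!: sum.neutral)
      qed
    qed
    then show "g \<in> ?P \<and> x = finsum (ideal_module n I) g {..<length L}"
      using gP by (simp add: fs)
  next
    fix f assume f: "f \<in> ?P \<and> x = finsum (ideal_module n I) f {..<length L}"
    then have xf: "x = (\<Sum>i<length L. f i)" using fs[of f] by simp
    show "f = g"
    proof (rule PiE_ext[of _ "{..<length L}"])
      fix j assume j: "j \<in> {..<length L}"
      show "f j = g j"
      proof (rule poly_mapping_eqI)
        fix m
        show "Poly_Mapping.lookup (f j) m = Poly_Mapping.lookup (g j) m"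
        proof (cases "m \<in> ?C j")
          case True
          have "Poly_Mapping.lookup (f j) m = Poly_Mapping.lookup x m"
            using lookup_f[of f j m] f j True xf by auto
          then show ?thesis using lookup_g[of j m] j True by simp
        next
          case False
          then have "m \<notin> Poly_Mapping.keys (f j)" using f j by (auto simp: PiE_iff)
          then show ?thesis using lookup_g[of j m] j False by (simp add: in_keys_iff)
        qed
      qed
    qed (use f gP in auto)
  qed
qed

section \<open>Existence of a Stanley decomposition\<close>

text \<open>
  Without a decomposition, \<^const>\<open>sdepth\<close> would be the unspecified maximum of the empty set.  Here the
  cone at \<open>b\<close> consists of the \<open>m\<close> with \<open>trunc k m = b\<close>.
\<close>

lemma stanley_decomposition_exists:
  assumes trunc: "\<And>m. m \<in> expos I \<Longrightarrow> trunc k m \<in> expos I"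
  shows "\<exists>D. stanley_decomposition D"
proof -
  define B where "B = {b \<in> expos I. \<forall>i. Poly_Mapping.lookup b i \<le> k}"
  let ?r = "\<lambda>m. restrict (Poly_Mapping.lookup m) {1..n}"
  \<comment> \<open>Finiteness of \<open>B\<close>: its elements vanish outside
    \<open>{1..n}\<close>, and their values there are at most \<open>k\<close>.\<close>
  have "inj_on ?r B"
  proof (rule inj_onI)
    fix x y assume xy: "x \<in> B" "y \<in> B" and eq: "?r x = ?r y"
    show "x = y"
    proof (rule poly_mapping_eqI)
      fix i
      show "Poly_Mapping.lookup x i = Poly_Mapping.lookup y i"
      proof (cases "i \<in> {1..n}")
        case True
        then show ?thesis using fun_cong[OF eq, of i] by simp
      next
        case False
        then have "i \<notin> Poly_Mapping.keys x" "i \<notin> Poly_Mapping.keys y"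
          using xy keys_expos_subset by (fastforce simp: B_def)+
        then show ?thesis by (simp add: in_keys_iff)
      qed
    qed
  qed
  moreover have "?r ` B \<subseteq> (\<Pi>\<^sub>E i\<in>{1..n}. {..k})" by (auto simp: B_def)
  then have "finite (?r ` B)" by (rule finite_subset) (simp add: finite_PiE)
  ultimately have "finite B" by (rule finite_imageD[rotated])
  then obtain bs where bs: "set bs = B" "distinct bs" using finite_distinct_list by blast
  \<comment> \<open>An exponent at the cap \<open>k\<close> may have been cut off and so is free to
    grow; one below the cap is fixed.\<close>
  define Z where "Z = (\<lambda>b. {i \<in> {1..n}. Poly_Mapping.lookup b i = k})"
  have cone_B: "m \<in> cone b (Z b) \<longleftrightarrow> b = trunc k m" if m: "m \<in> expos I" and b: "b \<in> B" for m b
  proof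
    assume "m \<in> cone b (Z b)"
    then have "Poly_Mapping.lookup b i = min k (Poly_Mapping.lookup m i)" for i
      using b unfolding cone_iff B_def Z_def by (smt (verit) min.absorb1 min.absorb2 mem_Collect_eq)
    then show "b = trunc k m" by (intro poly_mapping_eqI) simp
  next
    assume "b = trunc k m"
    moreover have "Poly_Mapping.lookup m i = 0" if "i \<notin> {1..n}" for i
      using keys_expos_subset[OF m] that by (auto simp: in_keys_iff)
    ultimately show "m \<in> cone b (Z b)" unfolding cone_iff Z_def by (auto simp: min_def)
  qed
  have "stanley_decomposition (map (\<lambda>(a, Z). (monom a, Z)) (map (\<lambda>b. (b, Z b)) bs))"
  proof (rule stanley_decomposition_of_cones)
    fix m assume m: "m \<in> expos I"
    then have "trunc k m \<in> set bs" using trunc by (simp add: bs B_def)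
    then obtain i where i: "i < length bs" "bs ! i = trunc k m" by (auto simp: in_set_conv_nth)
    have "\<exists>!i. i < length bs \<and> m \<in> cone (bs ! i) (Z (bs ! i))"
    proof (rule ex1I[of _ i])
      show "i < length bs \<and> m \<in> cone (bs ! i) (Z (bs ! i))"
        using i cone_B[OF m, of "bs ! i"] bs(1) nth_mem by metis
      fix j assume j: "j < length bs \<and> m \<in> cone (bs ! j) (Z (bs ! j))"
      then have "bs ! j = trunc k m" using cone_B[OF m, of "bs ! j"] bs(1) nth_mem by metis
      with i j bs(2) show "j = i" by (metis nth_eq_iff_index_eq)
    qed
    then show "\<exists>!i. i < length (map (\<lambda>b. (b, Z b)) bs) \<and>
      m \<in> cone (fst (map (\<lambda>b. (b, Z b)) bs ! i)) (snd (map (\<lambda>b. (b, Z b)) bs ! i))"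
      by (simp cong: conj_cong)
  qed (auto simp: bs B_def Z_def)
  then show ?thesis by blast
qed

section \<open>From cones to intervals of subsets\<close>

text \<open>By \<open>meet\<close> and \<open>powers\<close>, a vector equal to a large
  \<open>N\<close> on \<open>S\<close> and to 0 elsewhere lies in \<open>expos I\<close> exactly if
  \<open>S\<close> meets both \<open>X\<close> and \<open>Y\<close>. Testing the cones on these
  vectors yields the partition that \<open>interval_partition_bound\<close> needs.\<close>

lemma sdepth_decomposition_bound:
  assumes XY: "X \<union> Y = {1..n}" "X \<inter> Y = {}" "X \<noteq> {}" "Y \<noteq> {}"
    and meet: "\<And>m. m \<in> expos I \<Longrightarrow> Poly_Mapping.keys m \<inter> X \<noteq> {} \<and> Poly_Mapping.keys m \<inter> Y \<noteq> {}"
    and powers: "\<And>p q. p \<in> X \<Longrightarrow> q \<in> Y \<Longrightarrow>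
      Poly_Mapping.single p k + Poly_Mapping.single q k \<in> expos I"
    and D: "stanley_decomposition D"
  shows "2 * sdepth_decomposition D \<le> n + 2"
proof -
  let ?Z = "\<lambda>i. snd (D ! i)"
  obtain a where a: "\<And>i. i < length D \<Longrightarrow> a i \<in> expos I"
    and Z: "\<And>i. i < length D \<Longrightarrow> ?Z i \<subseteq> {1..n}"
    and part: "\<And>m. m \<in> expos I \<Longrightarrow> \<exists>!i. i < length D \<and> m \<in> cone (a i) (?Z i)"
    using stanley_decomposition_cones[OF D] by metis
  \<comment> \<open>The double sum is a crude upper bound for all exponents of all
    \<open>a i\<close>; \<open>Suc\<close> makes \<open>N\<close> strictly larger than these and
    than \<open>k\<close>.\<close>
  define N where "N = Suc (k + (\<Sum>i<length D. \<Sum>j\<in>{1..n}. Poly_Mapping.lookup (a i) j))"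
  have aN: "Poly_Mapping.lookup (a i) j < N" if i: "i < length D" for i j
  proof (cases "j \<in> {1..n}")
    case True
    then have "Poly_Mapping.lookup (a i) j \<le> (\<Sum>j\<in>{1..n}. Poly_Mapping.lookup (a i) j)"
      by (intro member_le_sum) auto
    also have "\<dots> \<le> (\<Sum>i<length D. \<Sum>j\<in>{1..n}. Poly_Mapping.lookup (a i) j)"
      using i by (intro member_le_sum[of i _ "\<lambda>i. \<Sum>j\<in>{1..n}. Poly_Mapping.lookup (a i) j"]) auto
    finally show ?thesis by (simp add: N_def)
  next
    case False
    then have "j \<notin> Poly_Mapping.keys (a i)" using keys_expos_subset[OF a[OF i]] by blast
    then show ?thesis by (simp add: in_keys_iff N_def)
  qed
  define w :: "nat set \<Rightarrow> (nat \<Rightarrow>\<^sub>0 nat)" where "w = (\<lambda>S. \<Sum>i\<in>S. Poly_Mapping.single i N)"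
  have w: "Poly_Mapping.lookup (w S) i = (if i \<in> S then N else 0)" if "finite S" for S i
    using that by (simp add: w_def lookup_sum lookup_single when_def)
  \<comment> \<open>Off \<open>S\<close> the value 0 forces \<open>a i\<close> to vanish; on
    \<open>S\<close> the value \<open>N\<close> differs from that of \<open>a i\<close>, which
    forces the index into \<open>?Z i\<close>.\<close>
  have w_cone: "w S \<in> cone (a i) (?Z i) \<longleftrightarrow> Poly_Mapping.keys (a i) \<subseteq> S \<and> S \<subseteq> ?Z i"
    if i: "i < length D" and S: "finite S" for i S
    unfolding cone_iff w[OF S] using aN[OF i]
    by (auto simp: in_keys_iff less_imp_le)
  have "2 * sdepth_decomposition D \<le> card (X \<union> Y) + 2"
  proof (rule interval_partition_bound[where A = "\<lambda>i. Poly_Mapping.keys (a i)" and Z = ?Z and l = "length D"])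
    show "finite X" "finite Y" using XY(1) by (metis finite_Un finite_atLeastAtMost)+
    show "X \<inter> Y = {}" "X \<noteq> {}" "Y \<noteq> {}" by fact+
    fix i assume i: "i < length D"
    show "Poly_Mapping.keys (a i) \<inter> X \<noteq> {} \<and> Poly_Mapping.keys (a i) \<inter> Y \<noteq> {}"
      using meet[OF a[OF i]] .
    show "?Z i \<subseteq> X \<union> Y" using Z[OF i] XY(1) by simp
    show "sdepth_decomposition D \<le> card (?Z i)" unfolding sdepth_decomposition_def
      using nth_mem[OF i] by (intro Min_le) (auto simp: image_iff split: prod.splits intro!: bexI[of _ "D ! i"])
  next
    fix S assume S: "S \<subseteq> X \<union> Y" "S \<inter> X \<noteq> {}" "S \<inter> Y \<noteq> {}"
    then obtain p q where pq: "p \<in> S" "p \<in> X" "q \<in> S" "q \<in> Y" by blast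
    have fin: "finite S" using S(1) XY(1) by (metis finite_atLeastAtMost finite_subset)
    \<comment> \<open>For \<open>p = q\<close> the two powers would add up to exponent
      \<open>2 * k\<close>, which \<open>N\<close> need not reach.\<close>
    have "p \<noteq> q" using pq XY(2) by blast
    then have "w S \<in> cone (Poly_Mapping.single p k + Poly_Mapping.single q k) {1..n}"
      unfolding cone_iff w[OF fin] using pq S(1) XY(1)
      by (auto simp: lookup_add lookup_single when_def N_def)
    then have "w S \<in> expos I" using cone_subset_expos[OF powers[OF pq(2,4)]] by blast
    from part[OF this] show "\<exists>!i. i < length D \<and> Poly_Mapping.keys (a i) \<subseteq> S \<and> S \<subseteq> ?Z i"
      using w_cone[OF _ fin] by (simp cong: conj_cong)
  qed
  then show ?thesis using XY(1) by simp
qed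

end

subsection \<open>Primary monomial ideals\<close>

text \<open>The polynomials all of whose terms involve a variable of \<open>T\<close> form an ideal
  that contains the generators.\<close>

lemma Idl_var_keys:
  assumes T: "T \<subseteq> {1..n}" and p: "p \<in> Idl\<^bsub>poly_ring n\<^esub> (var ` T :: 'k::field mpoly set)"
    and m: "m \<in> Poly_Mapping.keys p"
  shows "Poly_Mapping.keys m \<inter> T \<noteq> {}"
proof -
  interpret R: cring "poly_ring n :: 'k mpoly ring" by (rule cring_poly_ring)
  define J :: "'k mpoly set" where
    "J = {p \<in> polys_in {1..n}. \<forall>m\<in>Poly_Mapping.keys p. Poly_Mapping.keys m \<inter> T \<noteq> {}}"
  have Jmult: "r * p \<in> J" if "p \<in> J" "r \<in> polys_in {1..n}" for p r
  proof -
    have "Poly_Mapping.keys m \<inter> T \<noteq> {}" if m: "m \<in> Poly_Mapping.keys (r * p)" for m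
    proof -
      from m obtain a b where ab: "m = a + b" "b \<in> Poly_Mapping.keys p"
        using keys_mult[of r p] by blast
      then have "Poly_Mapping.keys b \<inter> T \<noteq> {}" using \<open>p \<in> J\<close> by (auto simp: J_def)
      moreover have "Poly_Mapping.keys b \<subseteq> Poly_Mapping.keys m"
        unfolding ab(1) by (auto simp: in_keys_iff lookup_add)
      ultimately show ?thesis by blast
    qed
    then show ?thesis using that polys_in_mult by (auto simp: J_def)
  qed
  have "ideal J (poly_ring n)"
  proof (rule idealI[OF R.ring_axioms])
    show "subgroup J (add_monoid (poly_ring n))"
    proof (rule R.add.subgroupI)
      show "J \<subseteq> carrier (poly_ring n)" by (auto simp: J_def poly_ring_def)
      have "0 \<in> J" by (auto simp: J_def polys_in_def)
      then show "J \<noteq> {}" by blast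
      show "x \<oplus>\<^bsub>poly_ring n\<^esub> y \<in> J" if "x \<in> J" "y \<in> J" for x y
        using that Poly_Mapping.keys_add[of x y] polys_in_add by (auto simp: poly_ring_def J_def)
      show "\<ominus>\<^bsub>poly_ring n\<^esub> x \<in> J" if "x \<in> J" for x
      proof -
        have "- x \<in> J" using Jmult[OF that, of "- 1"] by (auto simp: polys_in_def)
        moreover have "\<ominus>\<^bsub>poly_ring n\<^esub> x = - x"
          using that \<open>- x \<in> J\<close> by (intro R.minus_equality) (auto simp: poly_ring_def J_def)
        ultimately show ?thesis by simp
      qed
    qed
  qed (use Jmult in \<open>auto simp: poly_ring_def mult.commute\<close>)
  moreover have "var ` T \<subseteq> J"
    using T by (auto simp: J_def var_def monom_def polys_in_def)
  ultimately have "Idl\<^bsub>poly_ring n\<^esub> (var ` T) \<subseteq> J" by (rule R.genideal_minimal)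
  then show ?thesis using p m by (auto simp: J_def)
qed

lemma poly_ring_pow: "p [^]\<^bsub>poly_ring n\<^esub> (k::nat) = (p :: 'k::field mpoly) ^ k"
  by (induction k) (simp_all add: nat_pow_def poly_ring_def mult.commute)

lemma var_power: "var i ^ k = (monom (Poly_Mapping.single i k) :: 'k::field mpoly)"
  by (induction k) (simp_all add: var_def monom_def mult_single single_add[symmetric])

text \<open>The radical supplies a power of each variable of \<open>T\<close>, and it contains
  \<open>Q\<close>, so every monomial of \<open>Q\<close> involves such a variable. Primariness
  allows factors free of these variables to be cancelled, which is why high exponents can be
  capped.\<close>

lemma primary_monomial_ideal_expos:
  fixes Q :: "'k::field mpoly set"
  assumes Q: "monomial_ideal n Q" "primary_ideal Q (poly_ring n)"
    and rad: "radical (poly_ring n) Q = Idl\<^bsub>poly_ring n\<^esub> (var ` T)" and T: "T \<subseteq> {1..n}"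
  obtains k where "\<And>i N. i \<in> T \<Longrightarrow> k \<le> N \<Longrightarrow> Poly_Mapping.single i N \<in> expos Q"
    and "\<And>m N. m \<in> expos Q \<Longrightarrow> k \<le> N \<Longrightarrow> trunc N m \<in> expos Q"
    and "\<And>m. m \<in> expos Q \<Longrightarrow> Poly_Mapping.keys m \<inter> T \<noteq> {}"
proof -
  interpret monomial_ideal_module n Q by unfold_locales (rule Q(1))
  interpret R: cring "poly_ring n :: 'k mpoly ring" by (rule cring_poly_ring)
  have varT: "var ` T \<subseteq> carrier (poly_ring n :: 'k mpoly ring)"
    using T by (auto simp: poly_ring_def polys_in_def var_def monom_def)
  have rad_keys: "Poly_Mapping.keys m \<inter> T \<noteq> {}" if "monom m \<in> radical (poly_ring n) Q" for m
    using Idl_var_keys[OF T, of "monom m :: 'k mpoly" m] that rad by (simp add: monom_def)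
  have Qrad: "Q \<subseteq> radical (poly_ring n) Q"
    using ideal_I_D(5) by (auto simp: radical_def poly_ring_pow poly_ring_def intro!: exI[of _ 1])
  have "\<exists>k. Poly_Mapping.single i k \<in> expos Q" if "i \<in> T" for i
  proof -
    have "var i \<in> radical (poly_ring n) Q" unfolding rad using R.genideal_self[OF varT] that by auto
    then show ?thesis by (auto simp: radical_def poly_ring_pow var_power expos_def)
  qed
  then obtain e where e: "Poly_Mapping.single i (e i) \<in> expos Q" if "i \<in> T" for i by metis
  \<comment> \<open>A sum in place of a maximum: it dominates every \<open>e i\<close>.\<close>
  define k where "k = (\<Sum>i\<in>T. e i)"
  have single: "Poly_Mapping.single i N \<in> expos Q" if "i \<in> T" "k \<le> N" for i N
  proof -
    have "e i \<le> k" unfolding k_def using that finite_subset[OF T] by (intro member_le_sum) auto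
    then have "Poly_Mapping.single i N = Poly_Mapping.single i (e i) + Poly_Mapping.single i (N - e i)"
      using that by (simp add: single_add[symmetric])
    then show ?thesis using expos_add[OF e[OF that(1)]] that(1) T by auto
  qed
  \<comment> \<open>If an exponent in \<open>T\<close> reaches \<open>N\<close>, the capped monomial
    is still divisible by the \<open>N\<close>-th power of that variable, which lies in
    \<open>Q\<close>.\<close>
  have tr: "trunc N m \<in> expos Q" if m: "m \<in> expos Q" and N: "k \<le> N" for m N
  proof (cases "\<exists>i\<in>T. N \<le> Poly_Mapping.lookup m i")
    case True
    then obtain i where i: "i \<in> T" "N \<le> Poly_Mapping.lookup m i" by blast
    have "Poly_Mapping.lookup m j = 0" if "j \<notin> {1..n}" for j
      using keys_expos_subset[OF m] that by (auto simp: in_keys_iff)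
    then have "trunc N m \<in> cone (Poly_Mapping.single i N) {1..n}"
      unfolding cone_iff using i T by (auto simp: lookup_single when_def)
    then show ?thesis using cone_subset_expos[OF single[OF i(1) N]] by blast
  next
    case False
    \<comment> \<open>No exponent in \<open>T\<close> is cut off here, so the removed factor
      \<open>r\<close> avoids \<open>T\<close> and none of its positive powers lies in
      \<open>Q\<close>; primariness then puts the capped monomial into \<open>Q\<close>.\<close>
    define r where "r = m - trunc N m"
    have mr: "m = trunc N m + r"
      by (rule poly_mapping_eqI) (simp add: r_def lookup_add lookup_minus)
    have rT: "Poly_Mapping.keys r \<inter> T = {}"
      using False by (auto simp: r_def in_keys_iff lookup_minus)
    have sub: "Poly_Mapping.keys (trunc N m) \<subseteq> {1..n}" "Poly_Mapping.keys r \<subseteq> {1..n}"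
      using keys_expos_subset[OF m] by (auto simp: r_def in_keys_iff lookup_minus subset_iff)
    have car: "monom (trunc N m) \<in> carrier (poly_ring n :: 'k mpoly ring)"
      "monom r \<in> carrier (poly_ring n :: 'k mpoly ring)"
      using sub by (auto simp: poly_ring_def polys_in_def monom_def)
    have "monom (trunc N m) \<otimes>\<^bsub>poly_ring n\<^esub> monom r \<in> Q"
      using m mr by (simp add: poly_ring_def expos_def monom_def mult_single)
    then consider "monom (trunc N m) \<in> Q" | "monom r \<in> radical (poly_ring n) Q"
      using Q(2) car unfolding primary_ideal_def radical_def by blast
    then show ?thesis using rad_keys rT by cases (auto simp: expos_def)
  qed
  show thesis
    by (rule that[OF single tr]) (use rad_keys Qrad in \<open>auto simp: expos_def\<close>)
qed

section \<open>The intersection of the two primary ideals\<close>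

theorem theorem2p8:
  fixes Q Q' :: "'k::field mpoly set" and n t :: nat
  assumes "2 \<le> t" and "t < n" and "4 \<le> n"
    and "monomial_ideal n Q" and "primary_ideal Q (poly_ring n)"
    and "monomial_ideal n Q'" and "primary_ideal Q' (poly_ring n)"
    and "radical (poly_ring n) Q = Idl\<^bsub>poly_ring n\<^esub> (var ` {1..t})"
    and "radical (poly_ring n) Q' = Idl\<^bsub>poly_ring n\<^esub> (var ` {t+1..n})"
  shows "real (ideal_sdepth n (Q \<inter> Q')) \<le> (real n + 2) / 2"
proof -
  let ?X = "{1..t}" and ?Y = "{t+1..n}"
  have sub: "?X \<subseteq> {1..n}" "?Y \<subseteq> {1..n}" using assms(2) by auto
  obtain k where k: "\<And>i N. i \<in> ?X \<Longrightarrow> k \<le> N \<Longrightarrow> Poly_Mapping.single i N \<in> expos Q"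
    "\<And>m N. m \<in> expos Q \<Longrightarrow> k \<le> N \<Longrightarrow> trunc N m \<in> expos Q"
    "\<And>m. m \<in> expos Q \<Longrightarrow> Poly_Mapping.keys m \<inter> ?X \<noteq> {}"
    using primary_monomial_ideal_expos[OF assms(4,5,8) sub(1)] by metis
  obtain k' where k': "\<And>i N. i \<in> ?Y \<Longrightarrow> k' \<le> N \<Longrightarrow> Poly_Mapping.single i N \<in> expos Q'"
    "\<And>m N. m \<in> expos Q' \<Longrightarrow> k' \<le> N \<Longrightarrow> trunc N m \<in> expos Q'"
    "\<And>m. m \<in> expos Q' \<Longrightarrow> Poly_Mapping.keys m \<inter> ?Y \<noteq> {}"
    using primary_monomial_ideal_expos[OF assms(6,7,9) sub(2)] by metis
  interpret Q: monomial_ideal_module n Q by unfold_locales (rule assms(4))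
  interpret Q': monomial_ideal_module n Q' by unfold_locales (rule assms(6))
  interpret I: monomial_ideal_module n "Q \<inter> Q'"
    by unfold_locales (rule monomial_ideal_Int[OF assms(4,6)])
  have expos: "expos (Q \<inter> Q') = expos Q \<inter> expos Q'" by (auto simp: expos_def)
  have bound: "2 * I.sdepth_decomposition D \<le> n + 2" if D: "I.stanley_decomposition D" for D
  \<comment> \<open>\<open>k + k'\<close> dominates both thresholds, so one exponent serves both
    ideals: the power of \<open>p\<close> lies in \<open>Q\<close>, that of \<open>q\<close> in
    \<open>Q'\<close>, and their product in both.\<close>
  proof (rule I.sdepth_decomposition_bound[OF _ _ _ _ _ _ D, where X = ?X and Y = ?Y and k = "k + k'"])
    show "?X \<union> ?Y = {1..n}" "?X \<inter> ?Y = {}" "?X \<noteq> {}" "?Y \<noteq> {}"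
      using assms(1,2) by auto
    show "Poly_Mapping.keys m \<inter> ?X \<noteq> {} \<and> Poly_Mapping.keys m \<inter> ?Y \<noteq> {}"
      if "m \<in> expos (Q \<inter> Q')" for m
      using that k(3) k'(3) by (simp add: expos)
    show "Poly_Mapping.single p (k + k') + Poly_Mapping.single q (k + k') \<in> expos (Q \<inter> Q')"
      if "p \<in> ?X" "q \<in> ?Y" for p q
    proof -
      have pq: "Poly_Mapping.keys (Poly_Mapping.single p (k + k')) \<subseteq> {1..n}"
        "Poly_Mapping.keys (Poly_Mapping.single q (k + k')) \<subseteq> {1..n}"
        using that sub by auto
      show ?thesis unfolding expos
        using Q.expos_add[OF k(1)[OF that(1)] pq(2)] Q'.expos_add[OF k'(1)[OF that(2)] pq(1)]
        by (simp add: add.commute[of "Poly_Mapping.single q _"])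
    qed
  qed
  \<comment> \<open>The maximum defining \<open>sdepth\<close> is attained only if this set is
    nonempty and finite: existence of a decomposition gives the first, \<open>bound\<close> the
    second.\<close>
  define S where "S = {I.sdepth_decomposition D | D. I.stanley_decomposition D}"
  have "\<exists>D. I.stanley_decomposition D"
    by (rule I.stanley_decomposition_exists[of "k + k'"]) (use k(2) k'(2) in \<open>simp add: expos\<close>)
  then have "S \<noteq> {}" by (auto simp: S_def)
  moreover have "finite S"
    by (rule finite_subset[of _ "{..n + 2}"]) (use bound in \<open>force simp: S_def\<close>)+
  ultimately have "Max S \<in> S" by (rule Max_in[rotated])
  then have "2 * I.sdepth \<le> n + 2" using bound unfolding I.sdepth_def S_def by auto
  then show ?thesis unfolding ideal_sdepth_def by simp
qed

end
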